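(* The gapset filtrations of multiplicity $3$ are exactly the following finite sequences of sets: $$(12)^r(2)^s \quad\text{with } r\ge 1,\ 0\le s\le r,$$ $$(12)^r(1)^s \quad\text{with } r\ge 1,\ 0\le s\le r+1,$$ where $r,s$ are integers.
   Context: Notation: $\mathbb N=\{0,1,2,\dots\}$, $\mathbb N_+=\{1,2,\dots\}$, and $[a,b]$ denotes the integer interval $\{z\in\mathbb Z: a\le z\le b\}$. A gapset is a finite set $G\subset\mathbb N_+$ such that for all $z\in G$, if $z=x+y$ with $x,y\in\mathbb N_+$, then $x\in G$ or $y\in G$ (equivalently, $\mathbb N\setminus G$ is a numerical semigroup). Its multiplicity is the smallest integer $m\ge 1$ with $m\notin G$; its conductor is $c=1+\max(G)$ if $G\ne\emptyset$ and $c=0$ otherwise; its depth is $q=\lceil c/m\rceil$. For a gapset $G$ of multiplicity $m$ and depth $q$, put $G_i=G\cap[im+1,(i+1)m-1]$ and $F_i=-im+G_i=\{x-im: x\in G_i\}$ for $0\le i\le q-1$. The gapset filtration associated to $G$ is the finite sequence $(F_0,F_1,\dots,F_{q-1})$; it satisfies $[1,m-1]=F_0\supseteq F_1\supseteq\dots\supseteq F_{q-1}$. A gapset filtration of multiplicity $m$ is a sequence arising in this way from a gapset of multiplicity $m$. Compact notation: for $r\ge 1$, $s\ge 0$, $$(12)^r(1)^s=(\underbrace{\{1,2\},\dots,\{1,2\}}_{r},\underbrace{\{1\},\dots,\{1\}}_{s}),\qquad (12)^r(2)^s=(\underbrace{\{1,2\},\dots,\{1,2\}}_{r},\underbrace{\{2\},\dots,\{2\}}_{s}).$$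 *)

theory Defs
  imports Complex_Main
begin

definition gapset :: "nat set \<Rightarrow> bool" where
  "gapset G \<longleftrightarrow> finite G \<and> 0 \<notin> G \<and>
     (\<forall>z\<in>G. \<forall>x y. 1 \<le> x \<longrightarrow> 1 \<le> y \<longrightarrow> z = x + y \<longrightarrow> x \<in> G \<or> y \<in> G)"

definition multiplicity :: "nat set \<Rightarrow> nat" where
  "multiplicity G = (LEAST m. 1 \<le> m \<and> m \<notin> G)"

definition conductor :: "nat set \<Rightarrow> nat" where
  "conductor G = (if G = {} then 0 else 1 + Max G)"

definition depth :: "nat set \<Rightarrow> nat" where
  "depth G = nat \<lceil>real (conductor G) / real (multiplicity G)\<rceil>"

definition layer :: "nat set \<Rightarrow> nat \<Rightarrow> nat set" where
  "layer G i = G \<inter> {i * multiplicity G + 1 .. (i + 1) * multiplicity G - 1}"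

(* The subtraction on nat never truncates, since every element of layer G i
   exceeds i * multiplicity G. *)
definition shifted_layer :: "nat set \<Rightarrow> nat \<Rightarrow> nat set" where
  "shifted_layer G i = (\<lambda>x. x - i * multiplicity G) ` layer G i"

definition filtration_of :: "nat set \<Rightarrow> nat set list" where
  "filtration_of G = map (shifted_layer G) [0..<depth G]"

definition gapset_filtration :: "nat \<Rightarrow> nat set list \<Rightarrow> bool" where
  "gapset_filtration m Fs \<longleftrightarrow> (\<exists>G. gapset G \<and> multiplicity G = m \<and> Fs = filtration_of G)"

definition compact12_1 :: "nat \<Rightarrow> nat \<Rightarrow> nat set list" where
  "compact12_1 r s = replicate r {1, 2} @ replicate s {1}"

definition compact12_2 :: "nat \<Rightarrow> nat \<Rightarrow> nat set list" where
  "compact12_2 r s = replicate r {1, 2} @ replicate s {2}"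

end

theory Submission
  imports Defs
begin

text \<open>
  A gapset of multiplicity $3$ is determined by two numbers. Since $3$ is not a gap, subtracting
  $3$ from a gap above $3$ leaves a gap, so the gaps in each of the residue classes
  $1$ and $2$ modulo $3$ form an initial segment of that class, and no multiple of $3$ is a gap.
  Let \<open>a\<close> and \<open>b\<close> count the gaps in these classes. The least non-gaps in the classes are then
  $3a+1$ and $3b+2$ (the Apery elements), and closure of the non-gaps under addition only has to
  be tested on them. The sum $(3a+1)+(3b+2)$ is a multiple of $3$ and imposes nothing;
  $2(3a+1) = 3(2a)+2$ is a non-gap iff $b \leq 2a$, and $2(3b+2) = 3(2b+1)+1$ is a non-gap iff
  $a \leq 2b+1$. These are Kunz's inequalities in multiplicity $3$
  (lemma \<open>gapset_multiplicity_3_iff\<close>).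

  The \<open>i\<close>-th entry of the filtration contains $1$ iff $i < a$ and $2$ iff $i < b$, so the
  filtration consists of $\min(a,b)$ copies of $\{1,2\}$ followed by $|a-b|$ copies of the
  singleton of the more frequent class (lemma \<open>filtration_of_gaps3\<close>). With $r = \min(a,b)$ and
  $s = |a-b|$, Kunz's inequalities become $s \leq r$ when $a \leq b$, and $s \leq r+1$ when
  $b \leq a$.
\<close>

section \<open>Gapsets of multiplicity three\<close>

lemma multiplicity_eq_iff:
  assumes "finite G" and "m \<ge> 1"
  shows "multiplicity G = m \<longleftrightarrow> m \<notin> G \<and> {1..<m} \<subseteq> G"
proof
  assume mult: "multiplicity G = m"
  obtain k where "k \<notin> insert 0 G"
    using ex_new_if_finite[OF infinite_UNIV_nat, of "insert 0 G"] assms(1) by auto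
  then have "\<exists>k. 1 \<le> k \<and> k \<notin> G"
    by (intro exI[of _ k]) auto
  then have "m \<notin> G"
    using LeastI_ex[of "\<lambda>k. 1 \<le> k \<and> k \<notin> G"] mult unfolding multiplicity_def by blast
  moreover have "k \<in> G" if "k \<in> {1..<m}" for k
    using not_less_Least[of k "\<lambda>k. 1 \<le> k \<and> k \<notin> G"] that mult
    unfolding multiplicity_def by auto
  ultimately show "m \<notin> G \<and> {1..<m} \<subseteq> G"
    by blast
next
  assume "m \<notin> G \<and> {1..<m} \<subseteq> G"
  then show "multiplicity G = m"
    unfolding multiplicity_def using assms(2)
    by (intro Least_equality) (auto simp: subset_iff not_less[symmetric])
qed

lemma residue_mod_3_cases:
  fixes n :: nat
  obtains (zero) k where "n = 3 * k" | (one) k where "n = 3 * k + 1" | (two) k where "n = 3 * k + 2"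
proof -
  have "n mod 3 = 0 \<or> n mod 3 = 1 \<or> n mod 3 = 2"
    by linarith
  then show thesis
    using that mult_div_mod_eq[of 3 n] by (metis add.right_neutral)
qed

lemma finite_downward_closed_nat:
  fixes P :: "nat \<Rightarrow> bool"
  assumes "finite {i. P i}" and step: "\<And>i. P (Suc i) \<Longrightarrow> P i"
  shows "\<exists>a. \<forall>i. P i \<longleftrightarrow> i < a"
proof -
  have mono: "P i" if "P j" "i \<le> j" for i j
    using that(2,1) by (induction rule: inc_induct) (auto intro: step)
  obtain k where "\<not> P k"
    using ex_new_if_finite[OF infinite_UNIV_nat assms(1)] by blast
  then have "\<not> P (LEAST k. \<not> P k)"
    by (rule LeastI)
  then have "P i \<longleftrightarrow> i < (LEAST k. \<not> P k)" for i
    using mono not_less_Least[of i "\<lambda>k. \<not> P k"] by (meson not_le)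
  then show ?thesis
    by blast
qed

text \<open>
  The set with \<open>a\<close> elements $1, 4, \dots, 3a-2$ in residue class $1$ and \<open>b\<close> elements
  $2, 5, \dots, 3b-1$ in residue class $2$: the complement of the semigroup with Apery elements
  $3a+1$ and $3b+2$, when that is a semigroup.
\<close>
definition gaps3 :: "nat \<Rightarrow> nat \<Rightarrow> nat set" where
  "gaps3 a b = {n. n mod 3 = 1 \<and> n < 3 * a \<or> n mod 3 = 2 \<and> n < 3 * b}"

lemma finite_gaps3: "finite (gaps3 a b)"
  by (rule finite_subset[of _ "{..<3 * a + 3 * b}"]) (auto simp: gaps3_def)

lemma mem_gaps3:
  "3 * k \<notin> gaps3 a b"
  "3 * k + 1 \<in> gaps3 a b \<longleftrightarrow> k < a"
  "3 * k + 2 \<in> gaps3 a b \<longleftrightarrow> k < b"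
proof -
  have "(3 * k + 1) mod 3 = 1" "(3 * k + 2) mod 3 = 2"
    unfolding mod_mult_self4 by simp_all
  moreover have "3 * k + 1 < 3 * a \<longleftrightarrow> k < a" "3 * k + 2 < 3 * b \<longleftrightarrow> k < b"
    by linarith+
  ultimately show "3 * k \<notin> gaps3 a b" "3 * k + 1 \<in> gaps3 a b \<longleftrightarrow> k < a"
    "3 * k + 2 \<in> gaps3 a b \<longleftrightarrow> k < b"
    unfolding gaps3_def by simp_all
qed

lemma multiplicity_gaps3:
  assumes "a \<ge> 1" "b \<ge> 1"
  shows "multiplicity (gaps3 a b) = 3"
proof -
  have "{1..<3::nat} = {1, 2}"
    by auto
  moreover have "1 \<in> gaps3 a b" "2 \<in> gaps3 a b" "3 \<notin> gaps3 a b"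
    using assms by (simp_all add: gaps3_def)
  ultimately show ?thesis
    using multiplicity_eq_iff[OF finite_gaps3, of 3 a b] by simp
qed

text \<open>
  Suppose two non-gaps had a gap as their sum. Neither summand is a multiple of $3$, since adding
  such a number to a non-gap only moves it up in its class, beyond all gaps. The summands do not
  lie in different classes, since then the sum would be a multiple of $3$. So both lie in the same
  class, above its Apery element, and the sum is at least $2(3a+1)$ or $2(3b+2)$; the two
  inequalities say that the other class has no gaps from there on.
\<close>
lemma gapset_gaps3:
  assumes "b \<le> 2 * a" "a \<le> 2 * b + 1"
  shows "gapset (gaps3 a b)"
proof -
  have "x \<in> gaps3 a b \<or> y \<in> gaps3 a b"
    if "x + y \<in> gaps3 a b" for x y
  proof -
    obtain u where u: "x = 3 * u \<or> x = 3 * u + 1 \<or> x = 3 * u + 2"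
      by (cases x rule: residue_mod_3_cases) blast+
    obtain v where v: "y = 3 * v \<or> y = 3 * v + 1 \<or> y = 3 * v + 2"
      by (cases y rule: residue_mod_3_cases) blast+
    \<comment> \<open>The class and the position of the sum; a carry occurs once the residues add up to $3$ or more.\<close>
    have carry: "3 * u + 1 + (3 * v + 1) = 3 * (u + v) + 2"
      "3 * u + 2 + (3 * v + 2) = 3 * (u + v + 1) + 1"
      "3 * u + 1 + (3 * v + 2) = 3 * (u + v + 1)"
      "3 * u + 2 + (3 * v + 1) = 3 * (u + v + 1)"
      "3 * u + 3 * v = 3 * (u + v)"
      "3 * u + (3 * v + 1) = 3 * (u + v) + 1" "3 * u + 1 + 3 * v = 3 * (u + v) + 1"
      "3 * u + (3 * v + 2) = 3 * (u + v) + 2" "3 * u + 2 + 3 * v = 3 * (u + v) + 2"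
      by simp_all
    from u v show ?thesis
      using that assms
      by (elim disjE; hypsubst; simp only: carry mem_gaps3; linarith)
  qed
  then show ?thesis
    by (auto simp: gapset_def finite_gaps3) (auto simp: gaps3_def)
qed

text \<open>
  Given the gapset, each residue class meets it in an initial segment, as $3$ is a non-gap, and
  doubling the least non-gap of each class gives the two inequalities. The converse is the
  preceding lemma.
\<close>
theorem gapset_multiplicity_3_iff:
  "gapset G \<and> multiplicity G = 3 \<longleftrightarrow>
     (\<exists>a b. 1 \<le> a \<and> 1 \<le> b \<and> b \<le> 2 * a \<and> a \<le> 2 * b + 1 \<and> G = gaps3 a b)"
proof
  assume G: "gapset G \<and> multiplicity G = 3"
  then have fin: "finite G" and zero: "0 \<notin> G"
    by (simp_all add: gapset_def)
  have sum: "x \<in> G \<or> y \<in> G" if "x + y \<in> G" "1 \<le> x" "1 \<le> y" for x y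
    using G that unfolding gapset_def by blast
  have three: "3 \<notin> G" and small: "1 \<in> G" "2 \<in> G"
    using G multiplicity_eq_iff[OF fin, of 3] by auto
  have down: "n \<in> G" if "n + 3 \<in> G" "n \<ge> 1" for n
    using sum[of n 3] that three by simp
  have fin_class: "finite {i. 3 * i + c \<in> G}" for c
    using finite_vimageI[OF fin, of "\<lambda>i. 3 * i + c"] by (auto simp: inj_def vimage_def)
  have step: "3 * i + c \<in> G" if "3 * Suc i + c \<in> G" "c \<ge> 1" for i c
    using down[of "3 * i + c"] that by (simp add: add_ac)
  obtain a where a: "\<And>i. 3 * i + 1 \<in> G \<longleftrightarrow> i < a"
    using finite_downward_closed_nat[OF fin_class[of 1] step] by auto
  obtain b where b: "\<And>i. 3 * i + 2 \<in> G \<longleftrightarrow> i < b"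
    using finite_downward_closed_nat[OF fin_class[of 2] step] by auto
  have multiples: "3 * i \<notin> G" for i
  proof (induction i)
    case (Suc i)
    then show ?case
      using three step[of "i - 1" 3] by (cases i) (auto simp: add_ac)
  qed (use zero in simp)
  have "n \<in> G \<longleftrightarrow> n \<in> gaps3 a b" for n
    by (cases n rule: residue_mod_3_cases) (simp_all only: multiples a b mem_gaps3)
  then have "G = gaps3 a b"
    by blast
  moreover have "1 \<le> a" "1 \<le> b"
    using a[of 0] b[of 0] small by (simp_all add: numeral_2_eq_2)
  moreover have "b \<le> 2 * a"
  proof -
    have "3 * (2 * a) + 2 = (3 * a + 1) + (3 * a + 1)"
      by simp
    then have "3 * (2 * a) + 2 \<notin> G"
      using sum[of "3 * a + 1" "3 * a + 1"] a[of a] by (metis le_add2 less_irrefl)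
    then show ?thesis
      unfolding b by simp
  qed
  moreover have "a \<le> 2 * b + 1"
  proof -
    have "3 * (2 * b + 1) + 1 = (3 * b + 2) + (3 * b + 2)"
      by simp
    then have "3 * (2 * b + 1) + 1 \<notin> G"
      using sum[of "3 * b + 2" "3 * b + 2"] b[of b]
      by (metis le_add2 less_irrefl one_le_numeral order_trans)
    then show ?thesis
      unfolding a by simp
  qed
  ultimately show "\<exists>a b. 1 \<le> a \<and> 1 \<le> b \<and> b \<le> 2 * a \<and> a \<le> 2 * b + 1 \<and> G = gaps3 a b"
    by blast
next
  assume "\<exists>a b. 1 \<le> a \<and> 1 \<le> b \<and> b \<le> 2 * a \<and> a \<le> 2 * b + 1 \<and> G = gaps3 a b"
  then show "gapset G \<and> multiplicity G = 3"
    using gapset_gaps3 multiplicity_gaps3 by blast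
qed

section \<open>The filtration\<close>

text \<open>The largest gap is the larger of the class maxima $3a-2$ and $3b-1$.\<close>
lemma conductor_gaps3:
  assumes "a \<ge> 1" "b \<ge> 1"
  shows "conductor (gaps3 a b) = max (3 * a - 1) (3 * b)"
proof -
  have "Max (gaps3 a b) = max (3 * a - 2) (3 * b - 1)"
  proof (rule Max_eqI[OF finite_gaps3])
    show "n \<le> max (3 * a - 2) (3 * b - 1)" if "n \<in> gaps3 a b" for n
      using that by (cases n rule: residue_mod_3_cases) (auto simp only: mem_gaps3)
    show "max (3 * a - 2) (3 * b - 1) \<in> gaps3 a b"
    proof -
      have "3 * a - 2 = 3 * (a - 1) + 1" "3 * b - 1 = 3 * (b - 1) + 2"
        using assms by simp_all
      then have "3 * a - 2 \<in> gaps3 a b" "3 * b - 1 \<in> gaps3 a b"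
        using assms by (simp_all only: mem_gaps3)
      then show ?thesis
        unfolding max_def by simp
    qed
  qed
  moreover have "gaps3 a b \<noteq> {}"
    using assms by (auto simp: gaps3_def intro!: exI[of _ 1])
  ultimately show ?thesis
    using assms unfolding conductor_def by auto
qed

text \<open>
  Rounding up absorbs the difference between the two terms of the conductor: $3a-1$ and $3b$
  contribute \<open>a\<close> and \<open>b\<close> after division by $3$.
\<close>
lemma depth_gaps3:
  assumes "a \<ge> 1" "b \<ge> 1"
  shows "depth (gaps3 a b) = max a b"
proof -
  have "\<lceil>real (max (3 * a - 1) (3 * b)) / 3\<rceil> = int (max a b)"
    using assms by (intro ceiling_unique) (auto simp: max_def of_nat_diff field_simps)
  then show ?thesis
    unfolding depth_def conductor_gaps3[OF assms] multiplicity_gaps3[OF assms] by simp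
qed

lemma shifted_layer_gaps3:
  assumes "a \<ge> 1" "b \<ge> 1"
  shows "shifted_layer (gaps3 a b) i = (if i < a then {1} else {}) \<union> (if i < b then {2} else {})"
proof -
  have "{i * 3 + 1 .. (i + 1) * 3 - 1} = {3 * i + 1, 3 * i + 2}"
    by auto
  then show ?thesis
    using mem_gaps3[of i a b] unfolding shifted_layer_def layer_def multiplicity_gaps3[OF assms] by auto
qed

lemma filtration_of_gaps3:
  assumes "a \<ge> 1" "b \<ge> 1"
  shows "filtration_of (gaps3 a b) =
           (if a \<le> b then compact12_2 a (b - a) else compact12_1 b (a - b))"
  unfolding filtration_of_def depth_gaps3[OF assms] compact12_1_def compact12_2_def
  by (rule nth_equalityI)
    (auto simp: shifted_layer_gaps3[OF assms] nth_append max_def)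

section \<open>Classification of the filtrations\<close>

theorem theorem3p1:
  "{Fs. gapset_filtration 3 Fs} =
     {compact12_2 r s | r s. 1 \<le> r \<and> s \<le> r} \<union>
     {compact12_1 r s | r s. 1 \<le> r \<and> s \<le> r + 1}"
  (is "_ = ?two \<union> ?one")
proof (intro set_eqI iffI)
  fix Fs assume "Fs \<in> {Fs. gapset_filtration 3 Fs}"
  then obtain G where "gapset G" "multiplicity G = 3" "Fs = filtration_of G"
    unfolding gapset_filtration_def by blast
  then obtain a b where ab: "1 \<le> a" "1 \<le> b" "b \<le> 2 * a" "a \<le> 2 * b + 1"
    and Fs: "Fs = filtration_of (gaps3 a b)"
    using gapset_multiplicity_3_iff[of G] by blast
  show "Fs \<in> ?two \<union> ?one"
  proof (cases "a \<le> b")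
    case True
    then have "Fs = compact12_2 a (b - a)" "b - a \<le> a"
      using ab Fs filtration_of_gaps3 by auto
    then show ?thesis using ab by blast
  next
    case False
    then have "Fs = compact12_1 b (a - b)" "a - b \<le> b + 1"
      using ab Fs filtration_of_gaps3 by auto
    then show ?thesis using ab by blast
  qed
next
  have realised: "gapset_filtration 3 (filtration_of (gaps3 a b))"
    if "1 \<le> a" "1 \<le> b" "b \<le> 2 * a" "a \<le> 2 * b + 1" for a b
    unfolding gapset_filtration_def using that gapset_multiplicity_3_iff by blast
  fix Fs assume "Fs \<in> ?two \<union> ?one"
  then consider (two) r s where "Fs = compact12_2 r s" "1 \<le> r" "s \<le> r"
    | (one) r s where "Fs = compact12_1 r s" "1 \<le> r" "s \<le> r + 1"
    by blast
  then show "Fs \<in> {Fs. gapset_filtration 3 Fs}"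
  proof cases
    case two
    then show ?thesis
      using realised[of r "r + s"] filtration_of_gaps3[of r "r + s"] by simp
  next
    case one
    \<comment> \<open>For \<open>s = 0\<close> both families give the same sequence.\<close>
    then have "filtration_of (gaps3 (r + s) r) = Fs"
      using filtration_of_gaps3[of "r + s" r] by (auto simp: compact12_1_def compact12_2_def)
    then show ?thesis
      using realised[of "r + s" r] one by simp
  qed
qed

end
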